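(* Let $\mathbf{P} = (P,\preceq_+,\preceq_-)$ be a compatible double poset and let $\mathcal{L} \subseteq \mathcal{B}(P_+) \uplus \mathcal{B}(P_-)$, with $\mathcal{L}_+ := \mathcal{L} \cap \mathcal{B}(P_+)$ and $\mathcal{L}_- := \mathcal{L} \cap \mathcal{B}(P_-)$. Then \[ \overline{F}(\mathcal{L}) \ := \ \operatorname{conv}\left( \{ (2\mathbf{1}_{\Phi_+}, +1) : \Phi_+ \in \mathcal{L}_+ \} \cup \{ (-2\mathbf{1}_{\Phi_-}, -1) : \Phi_- \in \mathcal{L}_- \} \right) \] is a face of the double order polytope $\mathcal{TO}(\mathbf{P}) = \operatorname{conv}\{ (2\mathcal{O}(P_+)\times\{1\}) \cup (-2\mathcal{O}(P_-)\times\{-1\})\}$ if and only if (i) $\mathcal{L}_+ \subseteq \mathcal{B}(P_+)$ and $\mathcal{L}_- \subseteq \mathcal{B}(P_-)$ are embedded sublattices, and (ii) for all filters $\Phi_\sigma \subseteq \Phi_\sigma' \in \mathcal{B}(P_\sigma)$ for $\sigma = \pm$ such that $\Phi_+' \setminus \Phi_+ = \Phi_-' \setminus \Phi_-$, it holds that $\{\Phi_+,\Phi_-\} \subseteq \mathcal{L}$ if and only if $\{\Phi_+',\Phi_-'\} \subseteq \mathcal{L}$.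
   Context: A double poset $\mathbf{P}=(P,\preceq_+,\preceq_-)$ is a finite set with two partial orders; $P_\pm=(P,\preceq_\pm)$. It is compatible if $P_+$ and $P_-$ have a common linear extension. For a poset $P$, $\mathcal{O}(P)\subset\mathbb{R}^P$ is the order polytope (order-preserving maps $P\to[0,1]$), whose vertices are the indicator vectors $\mathbf{1}_\Phi$ of filters $\Phi$ (up-closed subsets). $\mathcal{B}(P)$ is the Birkhoff lattice of filters of $P$ ordered by inclusion. A subposet $\mathcal{L}\subseteq\mathcal{B}(P)$ is an embedded sublattice if for any two filters $\Phi,\Phi'\in\mathcal{B}(P)$: $\Phi\cup\Phi',\Phi\cap\Phi'\in\mathcal{L}$ if and only if $\Phi,\Phi'\in\mathcal{L}$. The disjoint union $\mathcal{B}(P_+)\uplus\mathcal{B}(P_-)$ keeps filters of $P_+$ and of $P_-$ as distinct elements. *)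

theory Defs
  imports "HOL-Analysis.Analysis"
begin

text \<open>
  A poset is a carrier \<open>P\<close> inside a finite ambient type together with a relation \<open>r\<close>
  satisfying \<^term>\<open>partial_order_on P r\<close>, where \<open>(x, y) \<in> r\<close> means \<open>x \<preceq> y\<close>.  Finiteness
  of \<open>P\<close> comes from the sort of the ambient type, and the empty poset is allowed.  The space
  of real functions on \<open>P\<close> is the coordinate subspace of the vectors in \<^typ>\<open>real ^ 'a\<close> that vanish
  off \<open>P\<close>.
\<close>

definition double_poset :: "'a::finite set \<Rightarrow> 'a rel \<Rightarrow> 'a rel \<Rightarrow> bool" where
  "double_poset P rp rm \<longleftrightarrow> partial_order_on P rp \<and> partial_order_on P rm"

definition linear_extension :: "'a set \<Rightarrow> 'a rel \<Rightarrow> 'a rel \<Rightarrow> bool" where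
  "linear_extension P r l \<longleftrightarrow> linear_order_on P l \<and> r \<subseteq> l"

definition compatible :: "'a set \<Rightarrow> 'a rel \<Rightarrow> 'a rel \<Rightarrow> bool" where
  "compatible P rp rm \<longleftrightarrow> (\<exists>l. linear_extension P rp l \<and> linear_extension P rm l)"

definition birkhoff :: "'a set \<Rightarrow> 'a rel \<Rightarrow> 'a set set" where
  "birkhoff P r = {\<Phi>. \<Phi> \<subseteq> P \<and> (\<forall>x\<in>\<Phi>. \<forall>y\<in>P. (x, y) \<in> r \<longrightarrow> y \<in> \<Phi>)}"

definition embedded_sublattice :: "'a set \<Rightarrow> 'a rel \<Rightarrow> 'a set set \<Rightarrow> bool" where
  "embedded_sublattice P r \<L> \<longleftrightarrow>
     \<L> \<subseteq> birkhoff P r \<and>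
     (\<forall>\<Phi>\<in>birkhoff P r. \<forall>\<Phi>'\<in>birkhoff P r.
        (\<Phi> \<union> \<Phi>' \<in> \<L> \<and> \<Phi> \<inter> \<Phi>' \<in> \<L>) \<longleftrightarrow> (\<Phi> \<in> \<L> \<and> \<Phi>' \<in> \<L>))"

definition order_polytope :: "'a::finite set \<Rightarrow> 'a rel \<Rightarrow> (real ^ 'a) set" where
  "order_polytope P r =
     {f. (\<forall>x\<in>P. f $ x \<in> {0..1}) \<and> (\<forall>x. x \<notin> P \<longrightarrow> f $ x = 0) \<and>
         monotone_on P (\<lambda>x y. (x, y) \<in> r) (\<le>) (\<lambda>x. f $ x)}"

definition indvec :: "'a::finite set \<Rightarrow> real ^ 'a" where
  "indvec \<Phi> = (\<chi> x. indicator \<Phi> x)"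

definition double_order_polytope ::
    "'a::finite set \<Rightarrow> 'a rel \<Rightarrow> 'a rel \<Rightarrow> ((real ^ 'a) \<times> real) set" where
  "double_order_polytope P rp rm =
     convex hull
       (((\<lambda>f. 2 *\<^sub>R f) ` order_polytope P rp) \<times> {1} \<union>
        ((\<lambda>f. (- 2) *\<^sub>R f) ` order_polytope P rm) \<times> {- 1})"

text \<open>
  Subsets of the disjoint union of the two Birkhoff lattices are sets over a sum type:
  \<open>Inl \<Phi>\<close> is the filter \<open>\<Phi>\<close> of the first order, \<open>Inr \<Phi>\<close> the filter \<open>\<Phi>\<close> of the second.
\<close>

definition plus_part :: "('a set + 'a set) set \<Rightarrow> 'a set set" where
  "plus_part \<L> = {\<Phi>. Inl \<Phi> \<in> \<L>}"

definition minus_part :: "('a set + 'a set) set \<Rightarrow> 'a set set" where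
  "minus_part \<L> = {\<Phi>. Inr \<Phi> \<in> \<L>}"

definition Fbar :: "('a::finite set + 'a set) set \<Rightarrow> ((real ^ 'a) \<times> real) set" where
  "Fbar \<L> =
     convex hull
       ({(2 *\<^sub>R indvec \<Phi>, 1) |\<Phi>. \<Phi> \<in> plus_part \<L>} \<union>
        {((- 2) *\<^sub>R indvec \<Phi>, - 1) |\<Phi>. \<Phi> \<in> minus_part \<L>})"

end

theory Submission
  imports Defs
begin

text \<open>
  A convex combination of filters splits into order-preserving maps \<open>f\<^sub>+\<close>, \<open>f\<^sub>-\<close> with total
  weights \<open>s\<^sub>+\<close>, \<open>s\<^sub>-\<close>, and the point it represents determines \<open>s\<^sub>+\<close>, \<open>s\<^sub>-\<close> and the difference
  \<open>f\<^sub>+ - f\<^sub>-\<close>.  For embedded sublattices the combination is supported in \<open>\<L>\<close> iff all level sets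
  \<open>{f\<^sub>\<sigma> \<ge> t}\<close>, \<open>0 < t \<le> s\<^sub>\<sigma>\<close>, lie in \<open>\<L>\<close>, so it remains to see that this property depends
  only on \<open>f\<^sub>+ - f\<^sub>-\<close>.  Pairs with a given difference are closed under pointwise minimum, so one
  may compare a pair with a smaller one; both maps are lowered at one element at a time, always
  the first remaining one in a common linear extension, and each such step is an instance of
  condition (ii).  Conversely, both conditions express equalities between sums of two vertices,
  which every face respects.
\<close>

section \<open>Level sets and the vertices as an indexed family\<close>

text \<open>\<open>s\<close> stands for the total weight of a combination and may exceed the maximum
  of \<open>f\<close>. Thresholds between the two give the empty filter, whose weight
  \<open>f\<close> itself cannot show.\<close>

definition level_sets_in :: "'a set \<Rightarrow> ('a \<Rightarrow> real) \<Rightarrow> real \<Rightarrow> 'a set set \<Rightarrow> bool" where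
  "level_sets_in P f s L \<longleftrightarrow> (\<forall>t. 0 < t \<longrightarrow> t \<le> s \<longrightarrow> {x \<in> P. t \<le> f x} \<in> L)"

abbreviation isotone_on :: "'a set \<Rightarrow> 'a rel \<Rightarrow> ('a \<Rightarrow> real) \<Rightarrow> bool" where
  "isotone_on P r f \<equiv> monotone_on P (\<lambda>x y. (x, y) \<in> r) (\<le>) f"

text \<open>The sum type keeps the filters of the two orders apart, and its finiteness lets
  coefficients be functions on all indices.\<close>

definition dop_vertex :: "'a::finite set + 'a set \<Rightarrow> (real ^ 'a) \<times> real" where
  "dop_vertex b = (case b of Inl \<Phi> \<Rightarrow> (2 *\<^sub>R indvec \<Phi>, 1) | Inr \<Phi> \<Rightarrow> ((- 2) *\<^sub>R indvec \<Phi>, - 1))"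

lemma indvec_nth [simp]: "indvec \<Phi> $ x = indicator \<Phi> x"
  by (simp add: indvec_def)

lemma indvec_inject [simp]: "indvec A = indvec B \<longleftrightarrow> A = B"
proof
  assume *: "indvec A = indvec B"
  have "x \<in> A \<longleftrightarrow> x \<in> B" for x
    using arg_cong[OF *, of "\<lambda>v. v $ x"] by (cases "x \<in> A"; cases "x \<in> B") auto
  then show "A = B" by blast
qed simp

lemma dop_vertex_simps [simp]:
  "dop_vertex (Inl \<Phi>) = (2 *\<^sub>R indvec \<Phi>, 1)"
  "dop_vertex (Inr \<Phi>) = ((- 2) *\<^sub>R indvec \<Phi>, - 1)"
  by (simp_all add: dop_vertex_def)

lemma Fbar_eq: "Fbar \<L> = convex hull (dop_vertex ` \<L>)"
proof -
  have "dop_vertex ` \<L> = {(2 *\<^sub>R indvec \<Phi>, 1) |\<Phi>. \<Phi> \<in> plus_part \<L>} \<union>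
        {((- 2) *\<^sub>R indvec \<Phi>, - 1) |\<Phi>. \<Phi> \<in> minus_part \<L>}" (is "_ = ?R")
  proof (intro equalityI subsetI)
    fix z assume "z \<in> dop_vertex ` \<L>"
    then obtain b where "b \<in> \<L>" "z = dop_vertex b" by blast
    then show "z \<in> ?R"
      by (cases b) (auto simp: plus_part_def minus_part_def)
  next
    fix z assume "z \<in> ?R"
    then consider \<Phi> where "Inl \<Phi> \<in> \<L>" "z = dop_vertex (Inl \<Phi>)"
      | \<Phi> where "Inr \<Phi> \<in> \<L>" "z = dop_vertex (Inr \<Phi>)"
      by (auto simp: plus_part_def minus_part_def)
    then show "z \<in> dop_vertex ` \<L>"
      by cases (blast intro: imageI)+
  qed
  then show ?thesis
    by (simp add: Fbar_def)
qed

subsection \<open>Convex hulls of indexed families\<close>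

lemma convex_hull_indexed:
  fixes v :: "'i::finite \<Rightarrow> 'e::real_vector"
  shows "convex hull (v ` I) =
    {\<Sum>i\<in>UNIV. c i *\<^sub>R v i | c. (\<forall>i. 0 \<le> c i) \<and> (\<forall>i. c i \<noteq> 0 \<longrightarrow> i \<in> I) \<and> sum c UNIV = 1}"
    (is "_ = ?R")
proof (rule equalityI)
  have "v i \<in> ?R" if "i \<in> I" for i
    using that by (intro CollectI exI[of _ "\<lambda>j. if j = i then 1 else 0"])
        (auto simp: if_distrib[of "\<lambda>x. x *\<^sub>R _"] cong: if_cong)
  moreover have "convex ?R"
  proof (rule convexI)
    fix x y and u w :: real
    assume "x \<in> ?R" "y \<in> ?R" and uw: "0 \<le> u" "0 \<le> w" "u + w = 1"
    then obtain a b where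
      a: "x = (\<Sum>i\<in>UNIV. a i *\<^sub>R v i)" "\<forall>i. 0 \<le> a i" "\<forall>i. a i \<noteq> 0 \<longrightarrow> i \<in> I" "sum a UNIV = 1" and
      b: "y = (\<Sum>i\<in>UNIV. b i *\<^sub>R v i)" "\<forall>i. 0 \<le> b i" "\<forall>i. b i \<noteq> 0 \<longrightarrow> i \<in> I" "sum b UNIV = 1"
      by blast
    have "i \<in> I" if "u * a i + w * b i \<noteq> 0" for i
    proof -
      from that have "a i \<noteq> 0 \<or> b i \<noteq> 0" by auto
      then show ?thesis using a(3) b(3) by blast
    qed
    then show "u *\<^sub>R x + w *\<^sub>R y \<in> ?R"
      using a b uw
      by (intro CollectI exI[of _ "\<lambda>i. u * a i + w * b i"])
        (auto simp: scaleR_right.sum sum.distrib scaleR_left_distrib simp flip: sum_distrib_left)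
  qed
  ultimately show "convex hull (v ` I) \<subseteq> ?R"
    by (intro hull_minimal) auto
next
  show "?R \<subseteq> convex hull (v ` I)"
  proof clarify
    fix c :: "'i \<Rightarrow> real"
    assume c: "\<forall>i. 0 \<le> c i" "\<forall>i. c i \<noteq> 0 \<longrightarrow> i \<in> I" "sum c UNIV = 1"
    have "(\<Sum>i\<in>UNIV. c i *\<^sub>R v i) = (\<Sum>i\<in>I. c i *\<^sub>R v i)"
      using c by (intro sum.mono_neutral_right) auto
    moreover have "sum c I = 1"
      using c by (subst c(3)[symmetric], intro sum.mono_neutral_left) auto
    ultimately show "(\<Sum>i\<in>UNIV. c i *\<^sub>R v i) \<in> convex hull (v ` I)"
      using c by (simp add: convex_sum hull_inc)
  qed
qed

text \<open>\<open>supp\<close> asks that no point of the smaller hull have a representation using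
  an index outside \<open>J\<close>. For a point inside a segment, mixing representations of the
  endpoints gives such a representation, and nonnegative coefficients cannot cancel.\<close>

lemma face_of_convex_hull_indexed:
  fixes v :: "'i::finite \<Rightarrow> 'e::real_vector"
  assumes "J \<subseteq> I"
    and supp: "\<And>a b i. \<lbrakk>\<And>i. 0 \<le> a i; \<And>i. a i \<noteq> 0 \<Longrightarrow> i \<in> I; sum a UNIV = (1::real);
        \<And>i. 0 \<le> b i; \<And>i. b i \<noteq> 0 \<Longrightarrow> i \<in> J; sum b UNIV = (1::real);
        (\<Sum>i\<in>UNIV. a i *\<^sub>R v i) = (\<Sum>i\<in>UNIV. b i *\<^sub>R v i); a i \<noteq> 0\<rbrakk> \<Longrightarrow> i \<in> J"
  shows "convex hull (v ` J) face_of convex hull (v ` I)"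
  unfolding face_of_def
proof (intro conjI ballI impI)
  show "convex hull (v ` J) \<subseteq> convex hull (v ` I)"
    using \<open>J \<subseteq> I\<close> by (intro hull_mono image_mono)
  fix x y z
  assume x: "x \<in> convex hull (v ` I)" and y: "y \<in> convex hull (v ` I)"
    and z: "z \<in> convex hull (v ` J)" and seg: "z \<in> open_segment x y"
  from x obtain a where
    a: "x = (\<Sum>i\<in>UNIV. a i *\<^sub>R v i)" "\<forall>i. 0 \<le> a i" "\<forall>i. a i \<noteq> 0 \<longrightarrow> i \<in> I" "sum a UNIV = 1"
    unfolding convex_hull_indexed by blast
  from y obtain b where
    b: "y = (\<Sum>i\<in>UNIV. b i *\<^sub>R v i)" "\<forall>i. 0 \<le> b i" "\<forall>i. b i \<noteq> 0 \<longrightarrow> i \<in> I" "sum b UNIV = 1"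
    unfolding convex_hull_indexed by blast
  from z obtain c where
    c: "z = (\<Sum>i\<in>UNIV. c i *\<^sub>R v i)" "\<forall>i. 0 \<le> c i" "\<forall>i. c i \<noteq> 0 \<longrightarrow> i \<in> J" "sum c UNIV = 1"
    unfolding convex_hull_indexed by blast
  obtain u where u: "0 < u" "u < 1" "z = (1 - u) *\<^sub>R x + u *\<^sub>R y"
    using seg by (auto simp: in_segment)
  define d where "d i = (1 - u) * a i + u * b i" for i
  have d0: "0 \<le> d i" for i
    using a(2) b(2) u(1,2) by (simp add: d_def)
  have d_pos: "d i \<noteq> 0" if "a i \<noteq> 0 \<or> b i \<noteq> 0" for i
  proof -
    have "0 \<le> (1 - u) * a i" "0 \<le> u * b i" using a(2) b(2) u(1,2) by simp_all
    moreover have "(1 - u) * a i \<noteq> 0 \<or> u * b i \<noteq> 0" using that u(1,2) by auto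
    ultimately show ?thesis unfolding d_def by linarith
  qed
  have dI: "i \<in> I" if "d i \<noteq> 0" for i
  proof -
    from that have "a i \<noteq> 0 \<or> b i \<noteq> 0" by (auto simp: d_def)
    then show ?thesis using a(3) b(3) by blast
  qed
  have d1: "sum d UNIV = 1"
    using a(4) b(4) by (simp add: d_def sum.distrib flip: sum_distrib_left)
  have "(\<Sum>i\<in>UNIV. d i *\<^sub>R v i) = (\<Sum>i\<in>UNIV. c i *\<^sub>R v i)"
    using u(3) unfolding a b c
    by (simp add: d_def scaleR_left_distrib sum.distrib scaleR_right.sum)
  then have "i \<in> J" if "d i \<noteq> 0" for i
    using supp[of d c i] that d0 dI d1 c(2-4) by blast
  then have "\<forall>i. a i \<noteq> 0 \<longrightarrow> i \<in> J" "\<forall>i. b i \<noteq> 0 \<longrightarrow> i \<in> J"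
    using d_pos by blast+
  then show "x \<in> convex hull (v ` J)" "y \<in> convex hull (v ` J)"
    unfolding convex_hull_indexed using a b by blast+
qed auto

section \<open>Vertices of hulls and exchanges along faces\<close>

text \<open>If \<open>x\<close> were not in \<open>S\<close>, every \<open>y\<close> in
  \<open>S\<close> would satisfy \<open>2 * (x \<bullet> y) < x \<bullet> x + y \<bullet> y \<le> 2
  * (x \<bullet> x)\<close>, so an open halfspace would contain the hull but not
  \<open>x\<close>.\<close>

lemma max_norm_in_convex_hull:
  fixes x :: "'e::real_inner"
  assumes "x \<in> convex hull S" and "\<And>y. y \<in> S \<Longrightarrow> norm y \<le> norm x"
  shows "x \<in> S"
proof (rule ccontr)
  assume "x \<notin> S"
  have "x \<bullet> y < x \<bullet> x" if "y \<in> S" for y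
  proof -
    have "0 < (x - y) \<bullet> (x - y)"
      using that \<open>x \<notin> S\<close> by (auto simp: inner_gt_zero_iff)
    moreover have "y \<bullet> y \<le> x \<bullet> x"
      using assms(2)[OF that] by (simp add: norm_le)
    ultimately show ?thesis
      by (simp add: inner_diff inner_commute)
  qed
  then have "convex hull S \<subseteq> {y. x \<bullet> y < x \<bullet> x}"
    by (intro hull_minimal convex_halfspace_lt) auto
  then show False
    using assms(1) by blast
qed

text \<open>The shear \<open>(x, c) \<mapsto> (x - c, c)\<close> carries all the points \<^term>\<open>dop_vertex b\<close> to
  vertices of the cube \<open>[-1, 1]\<^sup>n\<^sup>+\<^sup>1\<close>.\<close>

lemma dop_vertex_in_convex_hull:
  fixes b :: "'a::finite set + 'a set"
  assumes "dop_vertex b \<in> convex hull (dop_vertex ` \<L>)"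
  shows "b \<in> \<L>"
proof -
  define T :: "(real ^ 'a) \<times> real \<Rightarrow> (real ^ 'a) \<times> real"
    where "T z = ((\<chi> i. fst z $ i - snd z), snd z)" for z
  have lin: "linear T"
    by (rule linearI) (auto simp: T_def vec_eq_iff algebra_simps)
  \<comment> \<open>Every coordinate of an image is 1 or -1, so all images have equal norm and each
    of them is of maximal norm.\<close>
  have norm_eq: "norm (T (dop_vertex c)) = sqrt (CARD('a) + 1)" for c
  proof (cases c)
    case (Inl \<Phi>)
    have "(2 * indicator \<Phi> i - 1 :: real)\<^sup>2 = 1" for i
      by (auto simp: indicator_def)
    then show ?thesis
      using Inl by (simp add: T_def norm_Pair norm_vec_def L2_set_def)
  next
    case (Inr \<Phi>)
    have "(1 - 2 * indicator \<Phi> i :: real)\<^sup>2 = 1" for i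
      by (auto simp: indicator_def)
    then show ?thesis
      using Inr by (simp add: T_def norm_Pair norm_vec_def L2_set_def)
  qed
  have "T (dop_vertex b) \<in> T ` (convex hull (dop_vertex ` \<L>))"
    using assms by (rule imageI)
  then have "T (dop_vertex b) \<in> convex hull (T ` dop_vertex ` \<L>)"
    by (simp add: convex_hull_linear_image[OF lin])
  then have "T (dop_vertex b) \<in> T ` dop_vertex ` \<L>"
    by (rule max_norm_in_convex_hull) (auto simp: norm_eq)
  then obtain c where c: "c \<in> \<L>" "T (dop_vertex b) = T (dop_vertex c)"
    by blast
  then have "dop_vertex b = dop_vertex c"
    by (auto simp: T_def vec_eq_iff prod_eq_iff)
  then have "b = c"
    by (cases b; cases c) auto
  with c show ?thesis by simp
qed

text \<open>Two pairs of vertices with equal sums share their midpoint. It lies in the face because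
  of \<open>c\<close> and \<open>d\<close>, so the face property yields \<open>a\<close> and
  \<open>b\<close>.\<close>

lemma face_vertex_exchange:
  assumes face: "convex hull (dop_vertex ` \<L>) face_of convex hull (dop_vertex ` B)"
    and "a \<in> B" "b \<in> B" "c \<in> \<L>" "d \<in> \<L>"
    and eq: "dop_vertex a + dop_vertex b = dop_vertex c + dop_vertex d"
  shows "a \<in> \<L> \<and> b \<in> \<L>"
proof -
  let ?F = "convex hull (dop_vertex ` \<L>)"
  have "midpoint (dop_vertex c) (dop_vertex d) \<in> ?F"
    using \<open>c \<in> \<L>\<close> \<open>d \<in> \<L>\<close>
    by (meson closed_segment_subset_convex_hull hull_inc imageI midpoint_in_closed_segment subsetD)
  then have m: "midpoint (dop_vertex a) (dop_vertex b) \<in> ?F"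
    using eq by (simp add: midpoint_def)
  \<comment> \<open>For equal vertices the open segment is empty, but then the midpoint is the
    vertex itself.\<close>
  have "dop_vertex a \<in> ?F \<and> dop_vertex b \<in> ?F"
  proof (cases "dop_vertex a = dop_vertex b")
    case True
    then show ?thesis using m by simp
  next
    case False
    then show ?thesis
      using face m \<open>a \<in> B\<close> \<open>b \<in> B\<close> unfolding face_of_def
      by (meson hull_inc imageI midpoint_in_open_segment)
  qed
  then show ?thesis
    using dop_vertex_in_convex_hull by blast
qed

subsection \<open>Level sets\<close>

text \<open>Decomposition layer by layer: the smallest positive value \<open>m\<close> becomes the
  weight of the level set at \<open>m\<close>, and subtracting that layer leaves fewer positive
  values.\<close>

lemma level_sets_imp_weights:
  fixes f :: "'a::finite \<Rightarrow> real"
  assumes "level_sets_in P f s L" and "0 \<le> s" and "\<And>x. x \<in> P \<Longrightarrow> 0 \<le> f x \<and> f x \<le> s"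
    and "\<And>x. x \<notin> P \<Longrightarrow> f x = 0"
  shows "\<exists>c. (\<forall>\<Phi>. 0 \<le> c \<Phi>) \<and> (\<forall>\<Phi>. c \<Phi> \<noteq> 0 \<longrightarrow> \<Phi> \<in> L) \<and> sum c UNIV = s \<and>
    (\<forall>x. f x = (\<Sum>\<Phi>\<in>UNIV. c \<Phi> * indicator \<Phi> x))"
  using assms
\<comment> \<open>\<open>s\<close> counts among the values so that weight beyond the maximum of
  \<open>f\<close> is spent too; it goes to the empty filter.\<close>
proof (induction "card ({y \<in> insert s (f ` P). 0 < y})" arbitrary: f s rule: less_induct)
  case less
  let ?V = "{y \<in> insert s (f ` P). 0 < y}"
  show ?case
  proof (cases "s = 0")
    case True
    have "f x = 0" for x
      using less.prems True by (cases "x \<in> P") (auto intro: antisym)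
    then show ?thesis
      using True by (intro exI[of _ "\<lambda>_. 0"]) auto
  next
    case False
    then have s: "0 < s" using less.prems by simp
    have fin: "finite ?V" and ne: "s \<in> ?V" using s by auto
    define m where "m = Min ?V"
    have mV: "m \<in> ?V" unfolding m_def using fin ne by (intro Min_in) auto
    have m_le: "m \<le> y" if "y \<in> ?V" for y
      unfolding m_def using fin that by (intro Min_le)
    have m: "0 < m" "m \<le> s" using mV m_le[OF ne] by auto
    define \<Psi> where "\<Psi> = {x \<in> P. m \<le> f x}"
    have "\<Psi> \<in> L" using less.prems(1) m unfolding \<Psi>_def level_sets_in_def by blast
    \<comment> \<open>\<open>m\<close> is the least positive value, so \<open>f\<close> vanishes off
      \<open>\<Psi>\<close> and subtracting the layer never gives a negative number.\<close>
    have f0: "f x = 0" if "x \<notin> \<Psi>" for x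
    proof (rule ccontr)
      assume "f x \<noteq> 0"
      then have "x \<in> P" "0 < f x" using less.prems(3,4)[of x] by force+
      then show False using m_le[of "f x"] that by (auto simp: \<Psi>_def)
    qed
    define f' where "f' x = f x - m * indicator \<Psi> x" for x
    have f': "f' x = (if x \<in> \<Psi> then f x - m else 0)" for x
      using f0 by (simp add: f'_def indicator_def)
    have "\<exists>c. (\<forall>\<Phi>. 0 \<le> c \<Phi>) \<and> (\<forall>\<Phi>. c \<Phi> \<noteq> 0 \<longrightarrow> \<Phi> \<in> L) \<and> sum c UNIV = s - m \<and>
      (\<forall>x. f' x = (\<Sum>\<Phi>\<in>UNIV. c \<Phi> * indicator \<Phi> x))"
    proof (rule less.hyps)
      let ?V' = "{y \<in> insert (s - m) (f' ` P). 0 < y}"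
      \<comment> \<open>Adding \<open>m\<close> maps the remaining positive values injectively to
        old ones other than \<open>m\<close>.\<close>
      have sub: "(\<lambda>y. y + m) ` ?V' \<subseteq> ?V - {m}"
        using m by (auto simp: f' split: if_splits)
      have "card ?V' = card ((\<lambda>y. y + m) ` ?V')"
        by (simp add: card_image inj_on_def)
      also have "\<dots> \<le> card (?V - {m})"
        using fin sub by (intro card_mono) auto
      also have "\<dots> < card ?V"
        using fin mV by (rule card_Diff1_less)
      finally show "card ?V' < card ?V" .
      show "level_sets_in P f' (s - m) L"
        unfolding level_sets_in_def
      proof (intro allI impI)
        fix t assume t: "0 < t" "t \<le> s - m"
        have "{x \<in> P. t \<le> f' x} = {x \<in> P. t + m \<le> f x}"
          using t m by (auto simp: f' \<Psi>_def)
        then show "{x \<in> P. t \<le> f' x} \<in> L"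
          using less.prems(1) t m unfolding level_sets_in_def by simp
      qed
      show "0 \<le> s - m" using m by simp
      show "0 \<le> f' x \<and> f' x \<le> s - m" if "x \<in> P" for x
        using less.prems(3)[OF that] m by (auto simp: f' \<Psi>_def)
      show "f' x = 0" if "x \<notin> P" for x
        using that by (auto simp: f' \<Psi>_def)
    qed
    then obtain c where c: "\<forall>\<Phi>. 0 \<le> c \<Phi>" "\<forall>\<Phi>. c \<Phi> \<noteq> 0 \<longrightarrow> \<Phi> \<in> L" "sum c UNIV = s - m"
      "\<forall>x. f' x = (\<Sum>\<Phi>\<in>UNIV. c \<Phi> * indicator \<Phi> x)" by blast
    define e where "e \<Phi> = c \<Phi> + (if \<Phi> = \<Psi> then m else 0)" for \<Phi>
    show ?thesis
    proof (intro exI[of _ e] conjI allI impI)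
      show "0 \<le> e \<Phi>" for \<Phi> using c m by (simp add: e_def)
      show "\<Phi> \<in> L" if "e \<Phi> \<noteq> 0" for \<Phi>
        using that c \<open>\<Psi> \<in> L\<close> by (auto simp: e_def split: if_splits)
      show "sum e UNIV = s" using c by (simp add: e_def sum.distrib)
      fix x
      have "(\<Sum>\<Phi>\<in>UNIV. e \<Phi> * indicator \<Phi> x) =
          (\<Sum>\<Phi>\<in>UNIV. c \<Phi> * indicator \<Phi> x) + (\<Sum>\<Phi>\<in>UNIV. if \<Phi> = \<Psi> then m * indicator \<Psi> x else 0)"
        unfolding sum.distrib[symmetric] by (intro sum.cong) (auto simp: e_def algebra_simps)
      then show "f x = (\<Sum>\<Phi>\<in>UNIV. e \<Phi> * indicator \<Phi> x)"
        using c(4) unfolding f'_def by (simp add: algebra_simps)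
    qed
  qed
qed

lemma birkhoff_level_set:
  assumes "isotone_on P r f"
  shows "{x \<in> P. t \<le> f x} \<in> birkhoff P r"
  using assms unfolding birkhoff_def monotone_on_def by clarsimp (meson order_trans)

lemma birkhoff_Int: "A \<in> birkhoff P r \<Longrightarrow> B \<in> birkhoff P r \<Longrightarrow> A \<inter> B \<in> birkhoff P r"
  by (auto simp: birkhoff_def)

lemma birkhoff_Un: "A \<in> birkhoff P r \<Longrightarrow> B \<in> birkhoff P r \<Longrightarrow> A \<union> B \<in> birkhoff P r"
  by (auto simp: birkhoff_def)

lemma isotone_on_weights:
  fixes c :: "'a::finite set \<Rightarrow> real"
  assumes "\<And>\<Phi>. 0 \<le> c \<Phi>" "\<And>\<Phi>. c \<Phi> \<noteq> 0 \<Longrightarrow> \<Phi> \<in> birkhoff P r"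
  shows "isotone_on P r (\<lambda>x. \<Sum>\<Phi>\<in>UNIV. c \<Phi> * indicator \<Phi> x)"
proof (rule monotone_onI, rule sum_mono)
  fix x y \<Phi> assume "x \<in> P" "y \<in> P" "(x, y) \<in> r"
  then show "c \<Phi> * indicator \<Phi> x \<le> c \<Phi> * indicator \<Phi> y"
    using assms[of \<Phi>] by (cases "c \<Phi> = 0") (auto simp: birkhoff_def indicator_def)
qed

lemma embedded_sublattice_iff:
  assumes "embedded_sublattice P r L" "A \<in> birkhoff P r" "B \<in> birkhoff P r"
  shows "A \<union> B \<in> L \<and> A \<inter> B \<in> L \<longleftrightarrow> A \<in> L \<and> B \<in> L"
  by (rule bspec[OF bspec[OF conjunct2[OF assms(1)[unfolded embedded_sublattice_def]] assms(2)] assms(3)])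

text \<open>A combination reaches \<open>t\<close> at a point exactly when filters of total weight
  at least \<open>t\<close> contain it. The level set is therefore a union of intersections of
  members of \<open>L\<close>.\<close>

lemma weights_imp_level_sets:
  fixes c :: "'a::finite set \<Rightarrow> real"
  assumes emb: "embedded_sublattice P r L"
    and c0: "\<And>\<Phi>. 0 \<le> c \<Phi>" and cL: "\<And>\<Phi>. c \<Phi> \<noteq> 0 \<Longrightarrow> \<Phi> \<in> L"
  shows "level_sets_in P (\<lambda>x. \<Sum>\<Phi>\<in>UNIV. c \<Phi> * indicator \<Phi> x) (sum c UNIV) L"
  unfolding level_sets_in_def
proof (intro allI impI)
  fix t :: real assume t: "0 < t" "t \<le> sum c UNIV"
  let ?f = "\<lambda>x. \<Sum>\<Phi>\<in>UNIV. c \<Phi> * indicator \<Phi> x"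
  have LB: "L \<subseteq> birkhoff P r" using emb by (simp add: embedded_sublattice_def)
  have closed: "A \<union> B \<in> L" "A \<inter> B \<in> L" if "A \<in> L" "B \<in> L" for A B
  proof -
    have "A \<in> birkhoff P r" "B \<in> birkhoff P r" using that LB by blast+
    then show "A \<union> B \<in> L" "A \<inter> B \<in> L"
      using embedded_sublattice_iff[OF emb, of A B] that by simp_all
  qed
  have Inter: "\<Inter>S \<in> L" if "finite S" "S \<noteq> {}" "S \<subseteq> L" for S
    using that by (induction rule: finite_ne_induct) (simp_all add: closed)
  have Union: "\<Union>S \<in> L" if "finite S" "S \<noteq> {}" "S \<subseteq> L" for S
    using that by (induction rule: finite_ne_induct) (simp_all add: closed)
  define Q where "Q = {S. S \<subseteq> {\<Phi>. c \<Phi> \<noteq> 0} \<and> t \<le> sum c S}"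
  \<comment> \<open>Positive \<open>t\<close> excludes the empty family, whose intersection would be
    the whole type.\<close>
  have Qne: "S \<noteq> {}" if "S \<in> Q" for S using that t by (auto simp: Q_def)
  have "{\<Phi>. c \<Phi> \<noteq> 0} \<in> Q"
  proof -
    have "sum c {\<Phi>. c \<Phi> \<noteq> 0} = sum c UNIV" by (intro sum.mono_neutral_left) auto
    then show ?thesis using t by (simp add: Q_def)
  qed
  moreover have InterQ: "\<Inter>S \<in> L" if "S \<in> Q" for S
    using that Qne[OF that] by (intro Inter) (auto simp: Q_def intro: cL)
  ultimately have "\<Union>(Inter ` Q) \<in> L"
    by (intro Union) auto
  moreover have "{x \<in> P. t \<le> ?f x} = \<Union>(Inter ` Q)"
  proof (intro equalityI subsetI)
    fix x assume "x \<in> {x \<in> P. t \<le> ?f x}"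
    moreover have "?f x = sum c {\<Phi>. c \<Phi> \<noteq> 0 \<and> x \<in> \<Phi>}"
      by (intro sum.mono_neutral_cong_right) (auto simp: indicator_def)
    ultimately have "{\<Phi>. c \<Phi> \<noteq> 0 \<and> x \<in> \<Phi>} \<in> Q"
      by (auto simp: Q_def)
    then have "\<Inter>{\<Phi>. c \<Phi> \<noteq> 0 \<and> x \<in> \<Phi>} \<subseteq> \<Union>(Inter ` Q)" by (intro Union_upper imageI)
    then show "x \<in> \<Union>(Inter ` Q)" by (rule subsetD) simp
  next
    fix x assume "x \<in> \<Union>(Inter ` Q)"
    then obtain S where S: "S \<in> Q" "x \<in> \<Inter>S" by (rule UN_E)
    have "\<Inter>S \<in> birkhoff P r" using InterQ[OF S(1)] LB by (rule subsetD[rotated])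
    then have "\<Inter>S \<subseteq> P" unfolding birkhoff_def by (elim CollectE conjE)
    then have "x \<in> P" using S(2) by (rule subsetD)
    have "t \<le> sum c S" using S by (simp add: Q_def)
    also have "\<dots> = (\<Sum>\<Phi>\<in>S. c \<Phi> * indicator \<Phi> x)"
      using S by (intro sum.cong) auto
    also have "\<dots> \<le> ?f x" by (intro sum_mono2) (auto simp: c0)
    finally show "x \<in> {x \<in> P. t \<le> ?f x}" using \<open>x \<in> P\<close> by simp
  qed
  ultimately show "{x \<in> P. t \<le> ?f x} \<in> L" by simp
qed

text \<open>Converse of \<open>weights_imp_level_sets\<close>: here membership passes from a union
  and an intersection back to the two filters. With \<open>\<Psi>\<close> taken out of the
  combination, its traces on the level sets \<open>D u\<close> of the rest are shown to lie in
  \<open>L\<close>, down to a \<open>u\<close> with \<open>D u = P\<close>.\<close>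

lemma level_sets_imp_support:
  fixes c :: "'a::finite set \<Rightarrow> real"
  assumes emb: "embedded_sublattice P r L"
    and c0: "\<And>\<Phi>. 0 \<le> c \<Phi>" and cB: "\<And>\<Phi>. c \<Phi> \<noteq> 0 \<Longrightarrow> \<Phi> \<in> birkhoff P r"
    and lev: "level_sets_in P (\<lambda>x. \<Sum>\<Phi>\<in>UNIV. c \<Phi> * indicator \<Phi> x) (sum c UNIV) L"
    and "c \<Psi> \<noteq> 0"
  shows "\<Psi> \<in> L"
proof -
  define e where "e \<Phi> = (if \<Phi> = \<Psi> then 0 else c \<Phi>)" for \<Phi>
  define g where "g x = (\<Sum>\<Phi>\<in>UNIV. e \<Phi> * indicator \<Phi> x)" for x
  let ?q = "c \<Psi>" and ?s = "sum c UNIV"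
  define D where "D u = {x \<in> P. u \<le> g x}" for u
  have q: "0 < ?q" using c0[of \<Psi>] \<open>c \<Psi> \<noteq> 0\<close> by simp
  have \<Psi>: "\<Psi> \<in> birkhoff P r" using cB assms(5) by blast
  have e0: "0 \<le> e \<Phi>" for \<Phi> using c0 by (simp add: e_def)
  have "c = (\<lambda>\<Phi>. e \<Phi> + (if \<Phi> = \<Psi> then ?q else 0))"
    by (auto simp: e_def)
  then have "?s = (\<Sum>\<Phi>\<in>UNIV. e \<Phi> + (if \<Phi> = \<Psi> then ?q else 0))"
    by (rule arg_cong)
  then have e_sum: "sum e UNIV = ?s - ?q"
    by (simp add: sum.distrib)
  have g0: "0 \<le> g x" for x unfolding g_def using e0 by (intro sum_nonneg) auto
  have g1: "g x \<le> ?s - ?q" for x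
    unfolding e_sum[symmetric] g_def using e0 by (intro sum_mono) (auto simp: indicator_def)
  have f: "(\<Sum>\<Phi>\<in>UNIV. c \<Phi> * indicator \<Phi> x) = g x + ?q * indicator \<Psi> x" for x
  proof -
    have "c \<Phi> * indicator \<Phi> x =
        e \<Phi> * indicator \<Phi> x + (if \<Phi> = \<Psi> then ?q * indicator \<Psi> x else 0)" for \<Phi>
      by (simp add: e_def)
    then have "(\<Sum>\<Phi>\<in>UNIV. c \<Phi> * indicator \<Phi> x) =
        (\<Sum>\<Phi>\<in>UNIV. e \<Phi> * indicator \<Phi> x + (if \<Phi> = \<Psi> then ?q * indicator \<Psi> x else 0))"
      by (rule sum.cong[OF refl])
    then show ?thesis
      by (simp add: g_def sum.distrib)
  qed
  have D: "D u \<in> birkhoff P r" for u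
    unfolding D_def g_def
    by (intro birkhoff_level_set isotone_on_weights) (auto simp: e_def c0 cB split: if_splits)
  \<comment> \<open>On \<open>\<Psi>\<close> the whole sum exceeds \<open>g\<close> by
    \<open>c \<Psi>\<close>, so its level set at \<open>t\<close> joins \<open>D t\<close> with the
    part of \<open>\<Psi>\<close> where \<open>g\<close> reaches
    \<open>t - c \<Psi>\<close>.\<close>
  have level: "D t \<union> (D (t - ?q) \<inter> \<Psi>) \<in> L" if "0 < t" "t \<le> ?s" for t
  proof -
    have "{x \<in> P. t \<le> g x + ?q * indicator \<Psi> x} = D t \<union> (D (t - ?q) \<inter> \<Psi>)"
      using q by (auto simp: D_def indicator_def)
    then show ?thesis using lev that unfolding level_sets_in_def f by metis
  qed
  txt \<open>Descend from the top level in steps of \<open>c \<Psi>\<close>: the trace \<open>D t \<inter> \<Psi>\<close> is the meet of \<open>D t\<close>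
    with the next trace, and their join is a level set of the whole sum.\<close>
  have step: "D (?s - (real n + 1) * ?q) \<inter> \<Psi> \<in> L" if "real n * ?q < ?s" for n
    using that
  proof (induction n)
    case 0
    \<comment> \<open>\<open>g\<close> stays below the total weight by at least
      \<open>c \<Psi>\<close>, so \<open>D ?s\<close> is empty and the top level set is the trace
      alone.\<close>
    have "\<not> ?s \<le> g x" for x using g1[of x] q by linarith
    then have "D ?s = {}" by (simp add: D_def)
    then show ?case using level[of ?s] 0 by simp
  next
    case (Suc n)
    let ?t = "?s - (real n + 1) * ?q"
    have eq: "?s - (real (Suc n) + 1) * ?q = ?t - ?q" by (simp add: algebra_simps)
    have t: "0 < ?t" "?t \<le> ?s" using Suc.prems q by (auto simp: algebra_simps)
    have "real n * ?q < ?s" using t(1) q by (simp add: algebra_simps)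
    then have "D ?t \<inter> \<Psi> \<in> L" by (rule Suc.IH)
    moreover have "D ?t \<subseteq> D (?t - ?q)" using q by (auto simp: D_def)
    then have "D ?t \<inter> (D (?t - ?q) \<inter> \<Psi>) = D ?t \<inter> \<Psi>" by blast
    ultimately have "D ?t \<inter> (D (?t - ?q) \<inter> \<Psi>) \<in> L" by simp
    moreover have "D ?t \<union> (D (?t - ?q) \<inter> \<Psi>) \<in> L" using level t by blast
    ultimately have "D (?t - ?q) \<inter> \<Psi> \<in> L"
      using embedded_sublattice_iff[OF emb D[of ?t] birkhoff_Int[OF D[of "?t - ?q"] \<Psi>]] by simp
    then show ?case unfolding eq .
  qed
  have s: "0 < ?s"
    using q c0 by (intro sum_pos2[of _ \<Psi>]) auto
  \<comment> \<open>The largest \<open>n\<close> with \<open>real n * ?q < ?s\<close>. One more step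
    takes the threshold to zero or below, where nonnegativity of \<open>g\<close> makes
    \<open>D\<close> all of \<open>P\<close>.\<close>
  define n where "n = nat (\<lceil>?s / ?q\<rceil> - 1)"
  have "0 < ?s / ?q" using s q by simp
  then have "real n = of_int \<lceil>?s / ?q\<rceil> - 1" unfolding n_def by (simp add: of_nat_nat)
  then have "real n < ?s / ?q" "?s / ?q \<le> real n + 1" by linarith+
  then have n: "real n * ?q < ?s" "?s \<le> (real n + 1) * ?q"
    using q by (auto simp: field_simps)
  have "g x \<ge> ?s - (real n + 1) * ?q" for x using n(2) g0[of x] by linarith
  then have "D (?s - (real n + 1) * ?q) = P" by (auto simp: D_def)
  then show ?thesis
    using step[OF n(1)] \<Psi> by (simp add: birkhoff_def Int_absorb1)
qed

section \<open>Vertex descriptions of the order polytope and the double order polytope\<close>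

lemma order_polytope_level_sets:
  assumes "f \<in> order_polytope P r"
  shows "level_sets_in P (\<lambda>x. f $ x) 1 (birkhoff P r)"
  using assms by (auto simp: level_sets_in_def order_polytope_def intro: birkhoff_level_set)

lemma indvec_in_order_polytope:
  assumes "\<Phi> \<in> birkhoff P r"
  shows "indvec \<Phi> \<in> order_polytope P r"
  using assms by (auto simp: order_polytope_def birkhoff_def indicator_def intro!: monotone_onI)

text \<open>This is the layer decomposition with total weight 1, since the level sets of an
  order-preserving map are filters.\<close>

lemma order_polytope_convex_hull:
  fixes P :: "'a::finite set"
  shows "order_polytope P r \<subseteq> convex hull (indvec ` birkhoff P r)"
proof
  fix f assume f: "f \<in> order_polytope P r"
  then obtain c where c: "\<forall>\<Phi>. 0 \<le> c \<Phi>" "\<forall>\<Phi>. c \<Phi> \<noteq> 0 \<longrightarrow> \<Phi> \<in> birkhoff P r"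
    "sum c UNIV = 1" "\<forall>x. f $ x = (\<Sum>\<Phi>\<in>UNIV. c \<Phi> * indicator \<Phi> x)"
    using level_sets_imp_weights[OF order_polytope_level_sets[OF f]]
    by (auto simp: order_polytope_def)
  then have "f = (\<Sum>\<Phi>\<in>UNIV. c \<Phi> *\<^sub>R indvec \<Phi>)"
    by (simp add: vec_eq_iff)
  with c show "f \<in> convex hull (indvec ` birkhoff P r)"
    unfolding convex_hull_indexed by blast
qed

text \<open>Each of the two layers is an affine image of an order polytope, hence spanned by images
  of filter indicators. This gives the form that the criterion for faces requires.\<close>

lemma double_order_polytope_eq:
  "double_order_polytope P rp rm = convex hull (dop_vertex ` (birkhoff P rp <+> birkhoff P rm))"
    (is "_ = convex hull ?V")
proof -
  \<comment> \<open>The embedding is a linear map followed by translation by \<open>(0, l)\<close>.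
    It serves both layers, with \<open>k = 2\<close>, \<open>l = 1\<close> and with
    \<open>k = - 2\<close>, \<open>l = - 1\<close>.\<close>
  have scaled: "(k *\<^sub>R f, l) \<in> convex hull ((\<lambda>\<Phi>. (k *\<^sub>R indvec \<Phi>, l)) ` birkhoff P r)"
    if "f \<in> order_polytope P r" for f r and k l :: real
  proof -
    have "(\<lambda>x. (k *\<^sub>R x, l)) ` (convex hull (indvec ` birkhoff P r)) =
        (\<lambda>z. (0, l) + z) ` (\<lambda>x. (k *\<^sub>R x, 0)) ` (convex hull (indvec ` birkhoff P r))"
      by (simp add: image_image)
    also have "\<dots> = (\<lambda>z. (0, l) + z) ` (convex hull ((\<lambda>x. (k *\<^sub>R x, 0)) ` indvec ` birkhoff P r))"
      by (subst convex_hull_linear_image) (auto intro!: linearI simp: algebra_simps)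
    also have "\<dots> = convex hull ((\<lambda>\<Phi>. (k *\<^sub>R indvec \<Phi>, l)) ` birkhoff P r)"
      by (simp add: convex_hull_translation[symmetric] image_image)
    finally show ?thesis
      using that order_polytope_convex_hull by blast
  qed
  show ?thesis
    unfolding double_order_polytope_def
  proof (rule equalityI)
    have "(\<lambda>\<Phi>. (2 *\<^sub>R indvec \<Phi>, 1)) ` birkhoff P rp \<subseteq> ?V"
      "(\<lambda>\<Phi>. ((- 2) *\<^sub>R indvec \<Phi>, - 1)) ` birkhoff P rm \<subseteq> ?V"
      unfolding dop_vertex_simps[symmetric] by (intro image_subsetI imageI InlI InrI; assumption)+
    then have hull: "convex hull ((\<lambda>\<Phi>. (2 *\<^sub>R indvec \<Phi>, 1)) ` birkhoff P rp) \<subseteq> convex hull ?V"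
      "convex hull ((\<lambda>\<Phi>. ((- 2) *\<^sub>R indvec \<Phi>, - 1)) ` birkhoff P rm) \<subseteq> convex hull ?V"
      by (simp_all only: hull_mono)
    have "(2 *\<^sub>R f, 1) \<in> convex hull ?V" if "f \<in> order_polytope P rp" for f
      using scaled[OF that] hull(1) by (rule subsetD[rotated])
    moreover have "((- 2) *\<^sub>R f, - 1) \<in> convex hull ?V" if "f \<in> order_polytope P rm" for f
      using scaled[OF that] hull(2) by (rule subsetD[rotated])
    ultimately show "convex hull ((\<lambda>f. 2 *\<^sub>R f) ` order_polytope P rp \<times> {1} \<union>
        (\<lambda>f. (- 2) *\<^sub>R f) ` order_polytope P rm \<times> {- 1}) \<subseteq> convex hull ?V"
      by (intro hull_minimal) auto
    show "convex hull ?V \<subseteq> convex hull ((\<lambda>f. 2 *\<^sub>R f) ` order_polytope P rp \<times> {1} \<union>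
        (\<lambda>f. (- 2) *\<^sub>R f) ` order_polytope P rm \<times> {- 1})"
      by (intro hull_mono) (auto simp: indvec_in_order_polytope)
  qed
qed

subsection \<open>Decreasing both order-preserving maps simultaneously\<close>

text \<open>An element of \<open>D\<close> that is minimal in a common linear extension is minimal
  for both orders at once; this is where compatibility enters.\<close>

lemma compatible_minimal:
  assumes "compatible P rp rm" and "finite D" "D \<noteq> {}" "D \<subseteq> P"
  obtains x where "x \<in> D" "\<And>y. y \<in> D \<Longrightarrow> (y, x) \<in> rp \<union> rm \<Longrightarrow> y = x"
proof -
  obtain l where l: "linear_order_on P l" "rp \<subseteq> l" "rm \<subseteq> l"
    using assms by (auto simp: compatible_def linear_extension_def)
  then have "trans l" "antisym l" by (auto simp: order_on_defs)
  have "\<exists>x\<in>D. \<forall>y\<in>D. (y, x) \<in> l \<longrightarrow> y = x"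
    using assms(2-3)
  proof (induction rule: finite_ne_induct)
    case (insert a D)
    then obtain x where x: "x \<in> D" "\<forall>y\<in>D. (y, x) \<in> l \<longrightarrow> y = x" by blast
    show ?case
    proof (cases "(a, x) \<in> l")
      case True
      then show ?thesis
        using x \<open>trans l\<close> \<open>antisym l\<close> by (metis antisymD insert_iff transD)
    next
      case False
      then show ?thesis using x by blast
    qed
  qed simp
  then show ?thesis using l that by blast
qed

text \<open>\<open>S\<close>, \<open>T\<close> are the level sets before one value of each map
  changes and \<open>S'\<close>, \<open>T'\<close> those after it; only thresholds in the two
  half-open intervals are affected. Since \<open>exch\<close> speaks of pairs, an affected threshold
  on one side is paired with the upper end of the interval on the other.\<close>

lemma level_set_pair_transfer:
  assumes exch: "\<And>t u. \<lbrakk>ap < t; t \<le> bp; am < u; u \<le> bm; S t \<in> Lp; T u \<in> Lm\<rbrakk> \<Longrightarrow> S' t \<in> Lp \<and> T' u \<in> Lm"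
    and S: "\<And>t. \<not> (ap < t \<and> t \<le> bp) \<Longrightarrow> S' t = S t"
    and T: "\<And>u. \<not> (am < u \<and> u \<le> bm) \<Longrightarrow> T' u = T u"
    and ap: "0 \<le> ap" "ap < bp" "bp \<le> sp" and am: "0 \<le> am" "am < bm" "bm \<le> (sm::real)"
    and p: "\<And>t::real. 0 < t \<Longrightarrow> t \<le> sp \<Longrightarrow> S t \<in> Lp" and m: "\<And>u. 0 < u \<Longrightarrow> u \<le> sm \<Longrightarrow> T u \<in> Lm"
  shows "\<And>t. 0 < t \<Longrightarrow> t \<le> sp \<Longrightarrow> S' t \<in> Lp" and "\<And>u. 0 < u \<Longrightarrow> u \<le> sm \<Longrightarrow> T' u \<in> Lm"
proof -
  have b: "S bp \<in> Lp" "T bm \<in> Lm"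
    using ap am by (auto intro: p m)
  show "S' t \<in> Lp" if t: "0 < t" "t \<le> sp" for t
  proof (cases "ap < t \<and> t \<le> bp")
    case True
    then show ?thesis using exch[of t bm] p[OF t] b(2) am(2) by simp
  next
    case False
    then show ?thesis using S[OF False] p[OF t] by simp
  qed
  show "T' u \<in> Lm" if u: "0 < u" "u \<le> sm" for u
  proof (cases "am < u \<and> u \<le> bm")
    case True
    then show ?thesis using exch[of bp u] m[OF u] b(1) ap(2) by simp
  next
    case False
    then show ?thesis using T[OF False] m[OF u] by simp
  qed
qed

lemma level_sets_in_pair_cong:
  assumes exch: "\<And>t u. \<lbrakk>ap < t; t \<le> bp; am < u; u \<le> bm\<rbrakk> \<Longrightarrow>
      ({y \<in> P. t \<le> fp y} \<in> Lp \<and> {y \<in> P. u \<le> fm y} \<in> Lm) \<longleftrightarrow>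
      ({y \<in> P. t \<le> gp y} \<in> Lp \<and> {y \<in> P. u \<le> gm y} \<in> Lm)"
    and S: "\<And>t. \<not> (ap < t \<and> t \<le> bp) \<Longrightarrow> {y \<in> P. t \<le> fp y} = {y \<in> P. t \<le> gp y}"
    and T: "\<And>u. \<not> (am < u \<and> u \<le> bm) \<Longrightarrow> {y \<in> P. u \<le> fm y} = {y \<in> P. u \<le> gm y}"
    and bounds: "0 \<le> ap" "ap < bp" "bp \<le> sp" "0 \<le> am" "am < bm" "bm \<le> sm"
  shows "level_sets_in P fp sp Lp \<and> level_sets_in P fm sm Lm \<longleftrightarrow>
    level_sets_in P gp sp Lp \<and> level_sets_in P gm sm Lm"
proof
  assume "level_sets_in P fp sp Lp \<and> level_sets_in P fm sm Lm"
  then have f: "\<And>t. 0 < t \<Longrightarrow> t \<le> sp \<Longrightarrow> {y \<in> P. t \<le> fp y} \<in> Lp"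
    "\<And>u. 0 < u \<Longrightarrow> u \<le> sm \<Longrightarrow> {y \<in> P. u \<le> fm y} \<in> Lm"
    by (simp_all add: level_sets_in_def)
  note * = level_set_pair_transfer[OF exch[THEN iffD1, OF _ _ _ _ conjI] S[symmetric] T[symmetric] bounds f]
  show "level_sets_in P gp sp Lp \<and> level_sets_in P gm sm Lm"
    unfolding level_sets_in_def by (intro conjI allI impI *)
next
  assume "level_sets_in P gp sp Lp \<and> level_sets_in P gm sm Lm"
  then have g: "\<And>t. 0 < t \<Longrightarrow> t \<le> sp \<Longrightarrow> {y \<in> P. t \<le> gp y} \<in> Lp"
    "\<And>u. 0 < u \<Longrightarrow> u \<le> sm \<Longrightarrow> {y \<in> P. u \<le> gm y} \<in> Lm"
    by (simp_all add: level_sets_in_def)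
  note * = level_set_pair_transfer[OF exch[THEN iffD2, OF _ _ _ _ conjI] S T bounds g]
  show "level_sets_in P fp sp Lp \<and> level_sets_in P fm sm Lm"
    unfolding level_sets_in_def by (intro conjI allI impI *)
qed

text \<open>Lowering the value at \<open>x\<close> endangers only the relations from some
  \<open>y\<close> below \<open>x\<close>, and there \<open>f y \<le> h y \<le> h x\<close>.\<close>

lemma isotone_on_decrease:
  assumes iso: "isotone_on P r f" "isotone_on P r h" and "x \<in> P" "h x \<le> f x"
    and below: "\<And>y. y \<in> P \<Longrightarrow> (y, x) \<in> r \<Longrightarrow> y \<noteq> x \<Longrightarrow> f y \<le> h y"
  shows "isotone_on P r (f(x := h x))"
proof (rule monotone_onI)
  fix y z assume yz: "y \<in> P" "z \<in> P" "(y, z) \<in> r"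
  have "f y \<le> f z" "h y \<le> h z" using iso yz by (auto dest: monotone_onD)
  then show "(f(x := h x)) y \<le> (f(x := h x)) z"
    using yz below[of y] \<open>h x \<le> f x\<close> by auto
qed

text \<open>Induction on the number of elements where the maps still differ from their targets.
  Equal differences mean that both maps meet their targets at the same elements, so one element can
  be settled in both maps at once.\<close>

lemma level_sets_decrease_iff:
  fixes fp fm hp hm :: "'a::finite \<Rightarrow> real"
  assumes comp: "compatible P rp rm"
    and exch: "\<And>\<Phi>p \<Phi>p' \<Phi>m \<Phi>m'. \<lbrakk>\<Phi>p \<in> birkhoff P rp; \<Phi>p' \<in> birkhoff P rp;
        \<Phi>m \<in> birkhoff P rm; \<Phi>m' \<in> birkhoff P rm;
        \<Phi>p \<subseteq> \<Phi>p'; \<Phi>m \<subseteq> \<Phi>m'; \<Phi>p' - \<Phi>p = \<Phi>m' - \<Phi>m\<rbrakk> \<Longrightarrow>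
        (\<Phi>p \<in> Lp \<and> \<Phi>m \<in> Lm) \<longleftrightarrow> (\<Phi>p' \<in> Lp \<and> \<Phi>m' \<in> Lm)"
    and h: "isotone_on P rp hp" "isotone_on P rm hm" "\<And>x. x \<in> P \<Longrightarrow> 0 \<le> hp x \<and> 0 \<le> hm x"
    and f: "isotone_on P rp fp" "isotone_on P rm fm" "\<And>x. x \<in> P \<Longrightarrow> fp x \<le> sp \<and> fm x \<le> sm"
    and diff: "\<And>x. x \<in> P \<Longrightarrow> hp x \<le> fp x \<and> fp x - hp x = fm x - hm x"
  shows "level_sets_in P fp sp Lp \<and> level_sets_in P fm sm Lm \<longleftrightarrow>
    level_sets_in P hp sp Lp \<and> level_sets_in P hm sm Lm"
  using f diff
proof (induction "card {x \<in> P. hp x < fp x}" arbitrary: fp fm rule: less_induct)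
  case less
  let ?D = "{x \<in> P. hp x < fp x}"
  show ?case
  proof (cases "?D = {}")
    case True
    have "fp x = hp x \<and> fm x = hm x" if "x \<in> P" for x
      using True less.prems(4)[OF that] that by force
    then have "{x \<in> P. t \<le> fp x} = {x \<in> P. t \<le> hp x}" "{x \<in> P. t \<le> fm x} = {x \<in> P. t \<le> hm x}" for t
      by auto
    then show ?thesis by (simp add: level_sets_in_def)
  next
    case False
    obtain x where x: "x \<in> ?D" and xmin: "\<And>y. y \<in> ?D \<Longrightarrow> (y, x) \<in> rp \<union> rm \<Longrightarrow> y = x"
      using compatible_minimal[OF comp, of ?D] False by auto
    then have xP: "x \<in> P" and xlt: "hp x < fp x" "hm x < fm x"
      using less.prems(4)[of x] by auto
    define gp where "gp = fp(x := hp x)"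
    define gm where "gm = fm(x := hm x)"
    \<comment> \<open>Minimality of \<open>x\<close> in both orders means that everything strictly
      below it already has its target value.\<close>
    have below: "fp y \<le> hp y \<and> fm y \<le> hm y" if "y \<in> P" "(y, x) \<in> rp \<union> rm" "y \<noteq> x" for y
      using that xmin[of y] less.prems(4)[of y] by fastforce
    have iso: "isotone_on P rp gp" "isotone_on P rm gm"
      unfolding gp_def gm_def using xP xlt below
      by (auto intro!: isotone_on_decrease less.prems(1,2) h(1,2))
    have "level_sets_in P fp sp Lp \<and> level_sets_in P fm sm Lm \<longleftrightarrow>
        level_sets_in P gp sp Lp \<and> level_sets_in P gm sm Lm"
    proof (rule level_sets_in_pair_cong[of "hp x" "fp x" "hm x" "fm x"])
      show "0 \<le> hp x" "hp x < fp x" "fp x \<le> sp" "0 \<le> hm x" "hm x < fm x" "fm x \<le> sm"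
        using xP xlt h(3) less.prems(3) by auto
      show "{y \<in> P. t \<le> fp y} = {y \<in> P. t \<le> gp y}" if "\<not> (hp x < t \<and> t \<le> fp x)" for t
        using that xlt by (auto simp: gp_def)
      show "{y \<in> P. t \<le> fm y} = {y \<in> P. t \<le> gm y}" if "\<not> (hm x < t \<and> t \<le> fm x)" for t
        using that xlt by (auto simp: gm_def)
      fix t u assume tu: "hp x < t" "t \<le> fp x" "hm x < u" "u \<le> fm x"
      \<comment> \<open>At affected thresholds both level sets lose exactly \<open>x\<close>, so the
        two set differences in \<open>exch\<close> are both \<open>{x}\<close>.\<close>
      have "{y \<in> P. t \<le> gp y} = {y \<in> P. t \<le> fp y} - {x}"
        "{y \<in> P. u \<le> gm y} = {y \<in> P. u \<le> fm y} - {x}"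
        using tu by (auto simp: gp_def gm_def)
      then show "({y \<in> P. t \<le> fp y} \<in> Lp \<and> {y \<in> P. u \<le> fm y} \<in> Lm) \<longleftrightarrow>
          ({y \<in> P. t \<le> gp y} \<in> Lp \<and> {y \<in> P. u \<le> gm y} \<in> Lm)"
        using tu xP
        by (intro exch[symmetric] birkhoff_level_set iso less.prems(1,2)) auto
    qed
    also have "\<dots> \<longleftrightarrow> level_sets_in P hp sp Lp \<and> level_sets_in P hm sm Lm"
    proof (rule less.hyps)
      have "{y \<in> P. hp y < gp y} = ?D - {x}" by (auto simp: gp_def)
      then show "card {y \<in> P. hp y < gp y} < card ?D"
        using card_Diff1_less[OF _ x] by simp
      show "gp y \<le> sp \<and> gm y \<le> sm" "hp y \<le> gp y \<and> gp y - hp y = gm y - hm y" if "y \<in> P" for y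
        using less.prems(3,4)[OF that] xlt by (auto simp: gp_def gm_def)
    qed (rule iso)+
    finally show ?thesis .
  qed
qed

lemma isotone_on_min:
  assumes "isotone_on P r f" "isotone_on P r g"
  shows "isotone_on P r (\<lambda>x. min (f x) (g x))"
  by (intro monotone_onI min.mono monotone_onD[OF assms(1)] monotone_onD[OF assms(2)])

text \<open>Since \<open>fp - gp = fm - gm\<close> on \<open>P\<close>, both minima are attained by
  the same pair at each point. The pair of minima thus has the common difference and lies below both
  given pairs, which are each compared with it.\<close>

lemma level_sets_same_difference_iff:
  fixes fp fm gp gm :: "'a::finite \<Rightarrow> real"
  assumes comp: "compatible P rp rm"
    and exch: "\<And>\<Phi>p \<Phi>p' \<Phi>m \<Phi>m'. \<lbrakk>\<Phi>p \<in> birkhoff P rp; \<Phi>p' \<in> birkhoff P rp;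
        \<Phi>m \<in> birkhoff P rm; \<Phi>m' \<in> birkhoff P rm;
        \<Phi>p \<subseteq> \<Phi>p'; \<Phi>m \<subseteq> \<Phi>m'; \<Phi>p' - \<Phi>p = \<Phi>m' - \<Phi>m\<rbrakk> \<Longrightarrow>
        (\<Phi>p \<in> Lp \<and> \<Phi>m \<in> Lm) \<longleftrightarrow> (\<Phi>p' \<in> Lp \<and> \<Phi>m' \<in> Lm)"
    and f: "isotone_on P rp fp" "isotone_on P rm fm"
      "\<And>x. x \<in> P \<Longrightarrow> 0 \<le> fp x \<and> fp x \<le> sp \<and> 0 \<le> fm x \<and> fm x \<le> sm"
    and g: "isotone_on P rp gp" "isotone_on P rm gm"
      "\<And>x. x \<in> P \<Longrightarrow> 0 \<le> gp x \<and> gp x \<le> sp \<and> 0 \<le> gm x \<and> gm x \<le> sm"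
    and diff: "\<And>x. x \<in> P \<Longrightarrow> fp x - fm x = gp x - gm x"
  shows "level_sets_in P fp sp Lp \<and> level_sets_in P fm sm Lm \<longleftrightarrow>
    level_sets_in P gp sp Lp \<and> level_sets_in P gm sm Lm"
proof -
  define hp where "hp x = min (fp x) (gp x)" for x
  define hm where "hm x = min (fm x) (gm x)" for x
  have iso: "isotone_on P rp hp" "isotone_on P rm hm"
    unfolding hp_def hm_def using f g by (auto intro: isotone_on_min)
  have h0: "0 \<le> hp x \<and> 0 \<le> hm x" if "x \<in> P" for x
    using f(3)[OF that] g(3)[OF that] by (simp add: hp_def hm_def)
  have "level_sets_in P fp sp Lp \<and> level_sets_in P fm sm Lm \<longleftrightarrow>
    level_sets_in P hp sp Lp \<and> level_sets_in P hm sm Lm"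
  proof (rule level_sets_decrease_iff[OF comp exch iso h0 f(1,2)])
    show "fp x \<le> sp \<and> fm x \<le> sm" "hp x \<le> fp x \<and> fp x - hp x = fm x - hm x" if "x \<in> P" for x
      using f(3)[OF that] diff[OF that] by (auto simp: hp_def hm_def min_def)
  qed
  moreover have "level_sets_in P gp sp Lp \<and> level_sets_in P gm sm Lm \<longleftrightarrow>
    level_sets_in P hp sp Lp \<and> level_sets_in P hm sm Lm"
  proof (rule level_sets_decrease_iff[OF comp exch iso h0 g(1,2)])
    show "gp x \<le> sp \<and> gm x \<le> sm" "hp x \<le> gp x \<and> gp x - hp x = gm x - hm x" if "x \<in> P" for x
      using g(3)[OF that] diff[OF that] by (auto simp: hp_def hm_def min_def)
  qed
  ultimately show ?thesis by blast
qed

section \<open>Assembling the characterization of faces\<close>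

lemma sum_UNIV_Plus:
  fixes h :: "'b::finite + 'c::finite \<Rightarrow> 'd::comm_monoid_add"
  shows "sum h UNIV = (\<Sum>x\<in>UNIV. h (Inl x)) + (\<Sum>x\<in>UNIV. h (Inr x))"
  by (simp flip: UNIV_Plus_UNIV add: sum.Plus comp_def)

text \<open>All that a point reveals about its representation: the difference of the two maps and
  that of the two weights.\<close>

lemma sum_dop_vertex:
  fixes c :: "'a::finite set + 'a set \<Rightarrow> real"
  shows "fst (\<Sum>b\<in>UNIV. c b *\<^sub>R dop_vertex b) $ x =
      2 * ((\<Sum>\<Phi>\<in>UNIV. c (Inl \<Phi>) * indicator \<Phi> x) - (\<Sum>\<Phi>\<in>UNIV. c (Inr \<Phi>) * indicator \<Phi> x))"
    and "snd (\<Sum>b\<in>UNIV. c b *\<^sub>R dop_vertex b) = (\<Sum>\<Phi>\<in>UNIV. c (Inl \<Phi>)) - (\<Sum>\<Phi>\<in>UNIV. c (Inr \<Phi>))"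
  by (simp_all add: sum_UNIV_Plus fst_sum snd_sum sum_distrib_left sum_negf algebra_simps)

theorem theorem2p17:
  fixes P :: "'a::finite set" and rp rm :: "'a rel" and \<L> :: "('a set + 'a set) set"
  assumes "double_poset P rp rm"
    and "compatible P rp rm"
    and "\<L> \<subseteq> birkhoff P rp <+> birkhoff P rm"
  shows "Fbar \<L> face_of double_order_polytope P rp rm \<longleftrightarrow>
    (embedded_sublattice P rp (plus_part \<L>) \<and> embedded_sublattice P rm (minus_part \<L>)) \<and>
    (\<forall>\<Phi>p\<in>birkhoff P rp. \<forall>\<Phi>p'\<in>birkhoff P rp. \<forall>\<Phi>m\<in>birkhoff P rm. \<forall>\<Phi>m'\<in>birkhoff P rm.
       \<Phi>p \<subseteq> \<Phi>p' \<longrightarrow> \<Phi>m \<subseteq> \<Phi>m' \<longrightarrow> \<Phi>p' - \<Phi>p = \<Phi>m' - \<Phi>m \<longrightarrow>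
       ({Inl \<Phi>p, Inr \<Phi>m} \<subseteq> \<L> \<longleftrightarrow> {Inl \<Phi>p', Inr \<Phi>m'} \<subseteq> \<L>))"
    (is "?face \<longleftrightarrow> ?emb \<and> ?exch")
proof (intro iffI conjI)
  let ?B = "birkhoff P rp <+> birkhoff P rm"
  have parts: "plus_part \<L> \<subseteq> birkhoff P rp" "minus_part \<L> \<subseteq> birkhoff P rm"
    using assms(3) by (auto simp: plus_part_def minus_part_def)
  {
    assume ?face
    then have exchange: "a \<in> \<L> \<and> b \<in> \<L> \<longleftrightarrow> c \<in> \<L> \<and> d \<in> \<L>"
      if "a \<in> ?B" "b \<in> ?B" "c \<in> ?B" "d \<in> ?B" "dop_vertex a + dop_vertex b = dop_vertex c + dop_vertex d"
      for a b c d
      using that face_vertex_exchange[of \<L> ?B] unfolding Fbar_eq double_order_polytope_eq by metis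
    have "embedded_sublattice P rp (plus_part \<L>)"
      unfolding embedded_sublattice_def
    proof (intro conjI ballI parts)
      fix \<Phi> \<Phi>' assume "\<Phi> \<in> birkhoff P rp" "\<Phi>' \<in> birkhoff P rp"
      \<comment> \<open>Union and intersection together count each element as often as the two
        filters do, so the sums of the vertices agree.\<close>
      then have "Inl (\<Phi> \<union> \<Phi>') \<in> \<L> \<and> Inl (\<Phi> \<inter> \<Phi>') \<in> \<L> \<longleftrightarrow> Inl \<Phi> \<in> \<L> \<and> Inl \<Phi>' \<in> \<L>"
        by (intro exchange) (auto simp: birkhoff_Un birkhoff_Int vec_eq_iff indicator_def)
      then show "\<Phi> \<union> \<Phi>' \<in> plus_part \<L> \<and> \<Phi> \<inter> \<Phi>' \<in> plus_part \<L> \<longleftrightarrow>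
          \<Phi> \<in> plus_part \<L> \<and> \<Phi>' \<in> plus_part \<L>"
        by (simp add: plus_part_def)
    qed
    moreover have "embedded_sublattice P rm (minus_part \<L>)"
      unfolding embedded_sublattice_def
    proof (intro conjI ballI parts)
      fix \<Phi> \<Phi>' assume "\<Phi> \<in> birkhoff P rm" "\<Phi>' \<in> birkhoff P rm"
      then have "Inr (\<Phi> \<union> \<Phi>') \<in> \<L> \<and> Inr (\<Phi> \<inter> \<Phi>') \<in> \<L> \<longleftrightarrow> Inr \<Phi> \<in> \<L> \<and> Inr \<Phi>' \<in> \<L>"
        by (intro exchange) (auto simp: birkhoff_Un birkhoff_Int vec_eq_iff indicator_def)
      then show "\<Phi> \<union> \<Phi>' \<in> minus_part \<L> \<and> \<Phi> \<inter> \<Phi>' \<in> minus_part \<L> \<longleftrightarrow>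
          \<Phi> \<in> minus_part \<L> \<and> \<Phi>' \<in> minus_part \<L>"
        by (simp add: minus_part_def)
    qed
    ultimately show "embedded_sublattice P rp (plus_part \<L>)" "embedded_sublattice P rm (minus_part \<L>)"
      by blast+
    show ?exch
    proof (intro ballI impI)
      fix \<Phi>p \<Phi>p' \<Phi>m \<Phi>m'
      assume B: "\<Phi>p \<in> birkhoff P rp" "\<Phi>p' \<in> birkhoff P rp" "\<Phi>m \<in> birkhoff P rm" "\<Phi>m' \<in> birkhoff P rm"
        and sub: "\<Phi>p \<subseteq> \<Phi>p'" "\<Phi>m \<subseteq> \<Phi>m'" "\<Phi>p' - \<Phi>p = \<Phi>m' - \<Phi>m"
      \<comment> \<open>Both filters grow by the same set, whose contributions cancel because the
        two layers carry opposite signs.\<close>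
      have "dop_vertex (Inl \<Phi>p) + dop_vertex (Inr \<Phi>m) = dop_vertex (Inl \<Phi>p') + dop_vertex (Inr \<Phi>m')"
        using sub by (auto simp: vec_eq_iff indicator_def)
      then have "Inl \<Phi>p \<in> \<L> \<and> Inr \<Phi>m \<in> \<L> \<longleftrightarrow> Inl \<Phi>p' \<in> \<L> \<and> Inr \<Phi>m' \<in> \<L>"
        using B by (intro exchange) auto
      then show "{Inl \<Phi>p, Inr \<Phi>m} \<subseteq> \<L> \<longleftrightarrow> {Inl \<Phi>p', Inr \<Phi>m'} \<subseteq> \<L>"
        by simp
    qed
  }
  assume *: "?emb \<and> ?exch"
  then have emb: "embedded_sublattice P rp (plus_part \<L>)" "embedded_sublattice P rm (minus_part \<L>)"
    and ex: ?exch by blast+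
  have exch: "\<Phi>p \<in> plus_part \<L> \<and> \<Phi>m \<in> minus_part \<L> \<longleftrightarrow> \<Phi>p' \<in> plus_part \<L> \<and> \<Phi>m' \<in> minus_part \<L>"
    if "\<Phi>p \<in> birkhoff P rp" "\<Phi>p' \<in> birkhoff P rp" "\<Phi>m \<in> birkhoff P rm" "\<Phi>m' \<in> birkhoff P rm"
      "\<Phi>p \<subseteq> \<Phi>p'" "\<Phi>m \<subseteq> \<Phi>m'" "\<Phi>p' - \<Phi>p = \<Phi>m' - \<Phi>m" for \<Phi>p \<Phi>p' \<Phi>m \<Phi>m'
    using ex[rule_format, of \<Phi>p \<Phi>p' \<Phi>m \<Phi>m'] that(1-4) that(5-7)
    unfolding plus_part_def minus_part_def insert_subset mem_Collect_eq by simp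
  show ?face
    unfolding Fbar_eq double_order_polytope_eq
  \<comment> \<open>Given \<open>e\<close> supported in \<open>\<L>\<close>, any other
    representation \<open>c\<close> of the same point must be supported in \<open>\<L>\<close> as
    well.\<close>
  proof (rule face_of_convex_hull_indexed[OF assms(3)])
    fix c e :: "'a set + 'a set \<Rightarrow> real" and b
    assume c: "\<And>i. 0 \<le> c i" "\<And>i. c i \<noteq> 0 \<Longrightarrow> i \<in> ?B" "sum c UNIV = 1"
      and e: "\<And>i. 0 \<le> e i" "\<And>i. e i \<noteq> 0 \<Longrightarrow> i \<in> \<L>" "sum e UNIV = 1"
      and eq: "(\<Sum>i\<in>UNIV. c i *\<^sub>R dop_vertex i) = (\<Sum>i\<in>UNIV. e i *\<^sub>R dop_vertex i)"
      and "c b \<noteq> 0"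
    let ?f = "\<lambda>(w :: 'a set \<Rightarrow> real) x. \<Sum>\<Phi>\<in>UNIV. w \<Phi> * indicator \<Phi> x"
    let ?cp = "\<lambda>\<Phi>. c (Inl \<Phi>)" and ?cm = "\<lambda>\<Phi>. c (Inr \<Phi>)"
    let ?ep = "\<lambda>\<Phi>. e (Inl \<Phi>)" and ?em = "\<lambda>\<Phi>. e (Inr \<Phi>)"
    have cB: "\<Phi> \<in> birkhoff P rp" if "?cp \<Phi> \<noteq> 0" for \<Phi> using c(2)[OF that] by auto
    have cB': "\<Phi> \<in> birkhoff P rm" if "?cm \<Phi> \<noteq> 0" for \<Phi> using c(2)[OF that] by auto
    have eL: "\<Phi> \<in> plus_part \<L>" if "?ep \<Phi> \<noteq> 0" for \<Phi> using e(2)[OF that] by (simp add: plus_part_def)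
    have eL': "\<Phi> \<in> minus_part \<L>" if "?em \<Phi> \<noteq> 0" for \<Phi> using e(2)[OF that] by (simp add: minus_part_def)
    \<comment> \<open>The last coordinate gives the difference of the two weights and normalization
      gives their sum, so both are determined.\<close>
    have "sum ?cp UNIV - sum ?cm UNIV = sum ?ep UNIV - sum ?em UNIV"
      using arg_cong[OF eq, of snd] by (simp only: sum_dop_vertex)
    moreover have "sum ?cp UNIV + sum ?cm UNIV = sum ?ep UNIV + sum ?em UNIV"
      using c(3) e(3) by (simp add: sum_UNIV_Plus)
    ultimately have s: "sum ?cp UNIV = sum ?ep UNIV" "sum ?cm UNIV = sum ?em UNIV"
      by linarith+
    have diff: "?f ?cp x - ?f ?cm x = ?f ?ep x - ?f ?em x" for x
      using arg_cong[OF eq, of "\<lambda>z. fst z $ x"] unfolding sum_dop_vertex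
      by (simp only: mult_cancel_left) simp
    have bound: "0 \<le> ?f w x \<and> ?f w x \<le> sum w UNIV" if "\<And>\<Phi>. 0 \<le> w \<Phi>" for w x
      using that by (intro conjI sum_nonneg sum_mono) (auto simp: indicator_def)
    \<comment> \<open>The support of \<open>e\<close> puts its level sets into \<open>\<L>\<close>;
      equal differences carry this over to \<open>c\<close>, whose level sets then give back its
      support.\<close>
    have "level_sets_in P (?f ?ep) (sum ?ep UNIV) (plus_part \<L>)"
      "level_sets_in P (?f ?em) (sum ?em UNIV) (minus_part \<L>)"
      by (rule weights_imp_level_sets[OF emb(1) e(1) eL] weights_imp_level_sets[OF emb(2) e(1) eL'];
        assumption)+
    moreover have "level_sets_in P (?f ?cp) (sum ?ep UNIV) (plus_part \<L>) \<and>
        level_sets_in P (?f ?cm) (sum ?em UNIV) (minus_part \<L>) \<longleftrightarrow>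
      level_sets_in P (?f ?ep) (sum ?ep UNIV) (plus_part \<L>) \<and>
        level_sets_in P (?f ?em) (sum ?em UNIV) (minus_part \<L>)"
    proof (rule level_sets_same_difference_iff[OF assms(2) exch])
      show "isotone_on P rp (?f ?cp)" "isotone_on P rm (?f ?cm)"
        "isotone_on P rp (?f ?ep)" "isotone_on P rm (?f ?em)"
        by (rule isotone_on_weights[OF c(1) cB] isotone_on_weights[OF c(1) cB']
            isotone_on_weights[OF e(1) subsetD[OF parts(1) eL]]
            isotone_on_weights[OF e(1) subsetD[OF parts(2) eL']]; assumption)+
      show "0 \<le> ?f ?cp x \<and> ?f ?cp x \<le> sum ?ep UNIV \<and> 0 \<le> ?f ?cm x \<and> ?f ?cm x \<le> sum ?em UNIV" for x
        using bound[of ?cp x] bound[of ?cm x] c(1) s by simp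
      show "0 \<le> ?f ?ep x \<and> ?f ?ep x \<le> sum ?ep UNIV \<and> 0 \<le> ?f ?em x \<and> ?f ?em x \<le> sum ?em UNIV" for x
        using bound[of ?ep x] bound[of ?em x] e(1) by simp
    qed (assumption | rule diff)+
    ultimately have lev: "level_sets_in P (?f ?cp) (sum ?cp UNIV) (plus_part \<L>)"
      "level_sets_in P (?f ?cm) (sum ?cm UNIV) (minus_part \<L>)"
      using s by simp_all
    show "b \<in> \<L>"
    proof (cases b)
      case (Inl \<Phi>)
      then have "\<Phi> \<in> plus_part \<L>"
        using \<open>c b \<noteq> 0\<close> level_sets_imp_support[OF emb(1) c(1) cB lev(1)] by simp
      then show ?thesis using Inl by (simp add: plus_part_def)
    next
      case (Inr \<Phi>)
      then have "\<Phi> \<in> minus_part \<L>"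
        using \<open>c b \<noteq> 0\<close> level_sets_imp_support[OF emb(2) c(1) cB' lev(2)] by simp
      then show ?thesis using Inr by (simp add: minus_part_def)
    qed
  qed
qed

end
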